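(* A quandle is flat, connected, and finite if and only if it is isomorphic to a direct product of dihedral quandles with odd prime power cardinalities.
   Context: A quandle is a pair $(X,s)$ of a set $X$ and a map $s$ assigning to each $x\in X$ a map $s_x:X\to X$, such that: (Q1) $s_x(x)=x$ for all $x\in X$; (Q2) $s_x$ is bijective for all $x\in X$; (Q3) $s_x\circ s_y=s_{s_x(y)}\circ s_x$ for all $x,y\in X$. It is finite if $X$ is finite. A homomorphism $f:(X,s^X)\to(Y,s^Y)$ is a map $f:X\to Y$ with $f\circ s^X_x=s^Y_{f(x)}\circ f$ for all $x\in X$; an isomorphism is a bijective homomorphism, and two quandles are isomorphic if there is an isomorphism between them. $\mathrm{Inn}(X,s)$ is the group generated by $\{s_x\mid x\in X\}$; $(X,s)$ is connected if $\mathrm{Inn}(X,s)$ acts transitively on $X$. The group of displacements $G^0(X,s)$ is the group generated by $\{s_x\circ s_y\mid x,y\in X\}$; $(X,s)$ is flat if $G^0(X,s)$ is commutative. The dihedral quandle $R_n$ of order (cardinality) $n$ is the cyclic group $\mathbb{Z}_n$ of order $n$ with $s_x(y)=2x-y$. The direct product of quandles $(X,s^X)$ and $(Y,s^Y)$ is the quandle on $X\times Y$ with $s_{(x,y)}(x',y')=(s^X_x(x'),s^Y_y(y'))$, and similarly for finitely many factors; the direct products in the theorem are those of the form $R_{q_1}\times\cdots\times R_{q_n}$ with $q_1,\ldots,q_n$ odd prime powers. *)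

theory Defs
  imports
    "HOL-Algebra.Algebra"
    "HOL-Number_Theory.Prime_Powers"
begin

record 'a quandle = "'a partial_object" +
  smap :: "'a \<Rightarrow> 'a \<Rightarrow> 'a"

locale quandle =
  fixes Q :: "('a, 'b) quandle_scheme"
  assumes Q1: "x \<in> carrier Q \<Longrightarrow> smap Q x x = x"
    and Q2: "x \<in> carrier Q \<Longrightarrow> bij_betw (smap Q x) (carrier Q) (carrier Q)"
    and Q3: "\<lbrakk>x \<in> carrier Q; y \<in> carrier Q; z \<in> carrier Q\<rbrakk> \<Longrightarrow>
      smap Q x (smap Q y z) = smap Q (smap Q x y) (smap Q x z)"

definition quandle_hom ::
    "('a, 'c) quandle_scheme \<Rightarrow> ('b, 'd) quandle_scheme \<Rightarrow> ('a \<Rightarrow> 'b) set" where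
  "quandle_hom Q R = {f. f \<in> carrier Q \<rightarrow> carrier R \<and>
     (\<forall>x\<in>carrier Q. \<forall>y\<in>carrier Q. f (smap Q x y) = smap R (f x) (f y))}"

definition quandle_isomorphic ::
    "('a, 'c) quandle_scheme \<Rightarrow> ('b, 'd) quandle_scheme \<Rightarrow> bool" where
  "quandle_isomorphic Q R \<longleftrightarrow>
     (\<exists>f\<in>quandle_hom Q R. bij_betw f (carrier Q) (carrier R))"

text \<open>
  The values of \<^term>\<open>smap Q x\<close> outside the carrier are unspecified, so the permutation
  $s_x$ is represented in \<^const>\<open>BijGroup\<close> by its restriction to the carrier.
\<close>

definition sperm :: "('a, 'b) quandle_scheme \<Rightarrow> 'a \<Rightarrow> 'a \<Rightarrow> 'a" where
  "sperm Q x = restrict (smap Q x) (carrier Q)"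

lemma (in quandle) sperm_in_BijGroup:
  "x \<in> carrier Q \<Longrightarrow> sperm Q x \<in> carrier (BijGroup (carrier Q))"
  using Q2 by (auto simp: sperm_def BijGroup_def Bij_def)

definition Inn :: "('a, 'b) quandle_scheme \<Rightarrow> ('a \<Rightarrow> 'a) monoid" where
  "Inn Q = subgroup_generated (BijGroup (carrier Q)) {sperm Q x | x. x \<in> carrier Q}"

definition displacement_group :: "('a, 'b) quandle_scheme \<Rightarrow> ('a \<Rightarrow> 'a) monoid" where
  "displacement_group Q = subgroup_generated (BijGroup (carrier Q))
     {sperm Q x \<otimes>\<^bsub>BijGroup (carrier Q)\<^esub> sperm Q y | x y. x \<in> carrier Q \<and> y \<in> carrier Q}"

text \<open>
  A transitive action has exactly one orbit. The locale \<^locale>\<open>transitive_action\<close> only says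
  that there is at most one, which the empty quandle would satisfy vacuously.
\<close>

definition quandle_connected :: "('a, 'b) quandle_scheme \<Rightarrow> bool" where
  "quandle_connected Q \<longleftrightarrow>
     carrier Q \<noteq> {} \<and> transitive_action (Inn Q) (carrier Q) (\<lambda>g. g)"

definition quandle_flat :: "('a, 'b) quandle_scheme \<Rightarrow> bool" where
  "quandle_flat Q \<longleftrightarrow> comm_group (displacement_group Q)"

text \<open>
  The cyclic group of order $n > 0$ is represented by the residues $0, \ldots, n-1$.
\<close>

definition dihedral_quandle :: "nat \<Rightarrow> int quandle" where
  "dihedral_quandle n =
     \<lparr>carrier = {0..<int n}, smap = (\<lambda>x y. (2 * x - y) mod int n)\<rparr>"

lemma quandle_dihedral_quandle: "quandle (dihedral_quandle n)"
proof
  fix x assume "x \<in> carrier (dihedral_quandle n)"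
  then show "smap (dihedral_quandle n) x x = x"
    by (simp add: dihedral_quandle_def)
  show "bij_betw (smap (dihedral_quandle n) x)
      (carrier (dihedral_quandle n)) (carrier (dihedral_quandle n))"
    by (rule bij_betwI[where g = "smap (dihedral_quandle n) x"])
      (auto simp: dihedral_quandle_def mod_diff_right_eq)
next
  fix x y z
  have "(2 * x - (2 * y - z)) mod int n = (2 * (2 * x - y) - (2 * x - z)) mod int n"
    by (simp add: algebra_simps)
  also have "\<dots> = (2 * ((2 * x - y) mod int n) - (2 * x - z) mod int n) mod int n"
    by (rule mod_diff_cong) (simp_all only: mod_mult_right_eq mod_mod_trivial)
  finally show "smap (dihedral_quandle n) x (smap (dihedral_quandle n) y z) =
      smap (dihedral_quandle n) (smap (dihedral_quandle n) x y) (smap (dihedral_quandle n) x z)"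
    by (simp add: dihedral_quandle_def mod_diff_right_eq)
qed

text \<open>
  Over the empty index set this is the one-point quandle.
\<close>

definition quandle_prod ::
    "'i set \<Rightarrow> ('i \<Rightarrow> ('a, 'b) quandle_scheme) \<Rightarrow> ('i \<Rightarrow> 'a) quandle" where
  "quandle_prod I Q =
     \<lparr>carrier = (\<Pi>\<^sub>E i\<in>I. carrier (Q i)),
      smap = (\<lambda>x y. \<lambda>i\<in>I. smap (Q i) (x i) (y i))\<rparr>"

lemma quandle_quandle_prod:
  assumes "\<And>i. i \<in> I \<Longrightarrow> quandle (Q i)"
  shows "quandle (quandle_prod I Q)"
proof
  have closed: "smap (Q i) a b \<in> carrier (Q i)"
    if "i \<in> I" "a \<in> carrier (Q i)" "b \<in> carrier (Q i)" for i a b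
    using quandle.Q2[OF assms] that by (blast dest: bij_betwE)
  fix x assume x: "x \<in> carrier (quandle_prod I Q)"
  then show "smap (quandle_prod I Q) x x = x"
    by (auto simp: quandle_prod_def fun_eq_iff PiE_iff extensional_def
        intro: quandle.Q1[OF assms])
  define g where "g y = (\<lambda>i\<in>I. inv_into (carrier (Q i)) (smap (Q i) (x i)) (y i))" for y
  have b: "bij_betw (smap (Q i) (x i)) (carrier (Q i)) (carrier (Q i))" if "i \<in> I" for i
    using quandle.Q2[OF assms] that x by (auto simp: quandle_prod_def PiE_iff)
  show "bij_betw (smap (quandle_prod I Q) x)
      (carrier (quandle_prod I Q)) (carrier (quandle_prod I Q))"
  proof (rule bij_betwI[where g = g])
    show "smap (quandle_prod I Q) x \<in> carrier (quandle_prod I Q) \<rightarrow> carrier (quandle_prod I Q)"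
      using x closed by (auto simp: quandle_prod_def PiE_iff)
    show "g \<in> carrier (quandle_prod I Q) \<rightarrow> carrier (quandle_prod I Q)"
      using b by (auto simp: quandle_prod_def PiE_iff g_def bij_betw_def intro!: inv_into_into)
    show "g (smap (quandle_prod I Q) x y) = y" if "y \<in> carrier (quandle_prod I Q)" for y
      using that by (auto simp: quandle_prod_def PiE_iff g_def fun_eq_iff extensional_def
          intro: bij_betw_inv_into_left[OF b])
    show "smap (quandle_prod I Q) x (g y) = y" if "y \<in> carrier (quandle_prod I Q)" for y
      using that by (auto simp: quandle_prod_def PiE_iff g_def fun_eq_iff extensional_def
          intro: bij_betw_inv_into_right[OF b])
  qed
next
  fix x y z
  assume "x \<in> carrier (quandle_prod I Q)" "y \<in> carrier (quandle_prod I Q)"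
    "z \<in> carrier (quandle_prod I Q)"
  then show "smap (quandle_prod I Q) x (smap (quandle_prod I Q) y z) =
      smap (quandle_prod I Q) (smap (quandle_prod I Q) x y) (smap (quandle_prod I Q) x z)"
    by (auto simp: quandle_prod_def PiE_iff fun_eq_iff intro: quandle.Q3[OF assms])
qed

end

theory Submission
  imports Defs
begin

text \<open>
  Let $Q$ be flat, connected and finite, and let $D$ be its displacement group. Since
  $s_z(x) = s_z(s_x(x))$, every generator of the inner automorphism group moves a point within
  its $D$-orbit, so $D$ is already transitive. A transitive abelian permutation group is
  regular, hence $g \mapsto g(o)$ is a bijection from $D$ onto $Q$ for any base point $o$.

  Commutativity of $D$ determines the quandle operation under this identification. The
  displacement $s_o s_o$ fixes $o$ and commutes with the transitive group $D$, so $s_o$ is an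
  involution; rearranging $(s_a s_b)(s_o s_a) = (s_o s_a)(s_a s_b)$ then shows that conjugation by
  $s_o$ inverts every element of $D$. It follows that
  $s_{g(o)}(h(o)) = (g h^{-1} g)(o)$: the quandle $Q$ is the core of the abelian group $D$
  (theorem \<open>core_displacement_group_isomorphic\<close>). The same computation shows that
  $s_{h(y)} s_y = h^2$, so the generators of $D$, and therefore all its elements, are squares.
  As $D$ is finite, squaring is injective and $D$ has odd order.

  It remains to split $D$ into cyclic groups of prime power order, because the core of
  $\mathbb{Z}_q$ is $R_q$ and the core of a product is the product of the cores. Among all
  generating sets that consist of elements of prime power order, one that minimises the sum of the
  orders has no non-trivial relation: from such a relation one can manufacture an element of
  smaller order that can replace one of the generators (lemma \<open>relation_exchange\<close>).

  For the converse, the displacements of a product of dihedral quandles are translations, which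
  commute, and any two points $x$, $y$ are exchanged by $s_z$ with $z$ the midpoint
  $(x + y) / 2$, which exists because $2$ is invertible modulo an odd number.
\<close>

section \<open>Bases of finite abelian groups\<close>

text \<open>
  If the order of $x$ is $p^k m$ with $p \nmid m$, then Bezout coefficients write $x$ as a product
  of powers of $x^m$, which has order $p^k$, and of $x^{p^k}$, which has the smaller order $m$.
\<close>

lemma (in group) generate_primepow_ord:
  assumes "finite (carrier G)"
  shows "generate G {x \<in> carrier G. primepow (ord x)} = carrier G"
proof
  let ?P = "{x \<in> carrier G. primepow (ord x)}"
  show "generate G ?P \<subseteq> carrier G"
    by (intro generate_incl) auto
  have sub: "subgroup (generate G ?P) G"
    by (intro generate_is_subgroup) auto
  have "x \<in> generate G ?P" if "x \<in> carrier G" for x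
    using that
  proof (induction "ord x" arbitrary: x rule: less_induct)
    case less
    note x = \<open>x \<in> carrier G\<close>
    have pos: "ord x > 0"
      using ord_ge_1[OF assms x] by simp
    show ?case
    proof (cases "ord x = 1")
      case True
      then show ?thesis
        using x generate.one[of G ?P] by (metis ord_eq_1)
    next
      case False
      then obtain p where p: "Factorial_Ring.prime p" "p dvd ord x"
        using prime_factor_nat by blast
      obtain m where m: "ord x = p ^ multiplicity p (ord x) * m" "\<not> p dvd m"
        using multiplicity_decompose'[of "ord x" p] pos p(1)
        by (metis less_irrefl not_prime_unit)
      define k where "k = multiplicity p (ord x)"
      have n: "ord x = p ^ k * m"
        using m(1) by (simp add: k_def)
      have "k > 0"
        using p m(2) n by (cases k) auto
      have p1: "p ^ k > 1"
        by (rule one_less_power[OF prime_gt_1_nat[OF p(1)] \<open>k > 0\<close>])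
      have mpos: "m > 0"
        using pos n by (cases m) auto
      have "ord (x [^] m) = p ^ k"
        using ord_pow[OF x, of m] n mpos by simp
      then have 1: "x [^] m \<in> generate G ?P"
        using x p(1) \<open>k > 0\<close> by (intro generate.incl) auto
      have "ord (x [^] (p ^ k)) = m"
        using ord_pow[OF x, of "p ^ k"] n p1 by (auto simp del: power_eq_0_iff)
      then have 2: "x [^] (p ^ k) \<in> generate G ?P"
        using less(1)[of "x [^] (p ^ k)"] x n p1 mpos by simp
      have "coprime (int (p ^ k)) (int m)"
        using p(1) m(2) by (simp add: coprime_power_left_iff prime_imp_coprime_nat del: of_nat_power)
      then obtain u v where uv: "u * int (p ^ k) + v * int m = 1"
        by (metis bezout_int coprime_imp_gcd_eq_1)
      have "x = x [^] (int (p ^ k) * u + int m * v)"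
        using uv x by (simp add: mult.commute)
      also have "\<dots> = (x [^] (p ^ k)) [^] u \<otimes> (x [^] m) [^] v"
        using x by (simp only: int_pow_mult int_pow_pow[symmetric] int_pow_int)
      also have "\<dots> \<in> generate G ?P"
        by (intro subgroup.m_closed[OF sub] subgroup_int_pow_closed[OF sub] 1 2)
      finally show ?thesis .
    qed
  qed
  then show "carrier G \<subseteq> generate G ?P"
    by blast
qed

context comm_group
begin

lemma finprod_int_pow:
  assumes "f \<in> A \<rightarrow> carrier G"
  shows "finprod G f A [^] (k::int) = (\<Otimes>a\<in>A. f a [^] k)"
  using assms
proof (induction A rule: infinite_finite_induct)
  case (insert a A)
  then have "f a \<in> carrier G" "f \<in> A \<rightarrow> carrier G" "(\<lambda>a. f a [^] k) \<in> A \<rightarrow> carrier G"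
    by auto
  with insert show ?case
    by (simp add: int_pow_distrib)
qed auto

lemma finprod_mem_subgroup:
  assumes "subgroup H G" "\<And>a. a \<in> A \<Longrightarrow> f a \<in> H"
  shows "finprod G f A \<in> H"
  using assms(2)
proof (induction A rule: infinite_finite_induct)
  case (insert a A)
  then have "f \<in> A \<rightarrow> carrier G" "f a \<in> carrier G"
    using subgroup.mem_carrier[OF assms(1)] by auto
  with insert show ?case
    by (simp add: subgroup.m_closed[OF assms(1)])
qed (auto simp: subgroup.one_closed[OF assms(1)])

lemma generate_eq_finprod:
  assumes "finite S" "S \<subseteq> carrier G" "x \<in> generate G S"
  shows "\<exists>m :: 'a \<Rightarrow> int. x = (\<Otimes>s\<in>S. s [^] m s)"
  using assms(3)
proof (induction x rule: generate.induct)
  case one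
  have "(\<Otimes>s\<in>S. s [^] (0::int)) = \<one>"
    by simp
  then show ?case
    by (intro exI[of _ "\<lambda>_. 0"]) simp
next
  case (incl h)
  have "(\<Otimes>s\<in>S. s [^] (if s = h then 1 else 0 :: int)) = (\<Otimes>s\<in>S. if s = h then s else \<one>)"
    using assms(2) by (intro finprod_cong') auto
  also have "\<dots> = h"
    using finprod_singleton_swap[of h S "\<lambda>s. s"] incl assms(1,2) by auto
  finally show ?case
    by (intro exI[of _ "\<lambda>s. if s = h then 1 else 0"]) simp
next
  case (inv h)
  have "(\<Otimes>s\<in>S. s [^] (if s = h then - 1 else 0 :: int)) = (\<Otimes>s\<in>S. if s = h then inv s else \<one>)"
    using assms(2) by (intro finprod_cong') (auto simp: int_pow_neg)
  also have "\<dots> = inv h"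
    using finprod_singleton_swap[of h S "\<lambda>s. inv s"] inv assms(1,2) by auto
  finally show ?case
    by (intro exI[of _ "\<lambda>s. if s = h then - 1 else 0"]) simp
next
  case (eng x y)
  then obtain m k :: "'a \<Rightarrow> int"
    where "x = (\<Otimes>s\<in>S. s [^] m s)" "y = (\<Otimes>s\<in>S. s [^] k s)"
    by blast
  moreover have "(\<Otimes>s\<in>S. s [^] (m s + k s)) = (\<Otimes>s\<in>S. s [^] m s \<otimes> s [^] k s)"
    using assms(2) by (intro finprod_cong') (auto simp: int_pow_mult)
  moreover have "\<dots> = (\<Otimes>s\<in>S. s [^] m s) \<otimes> (\<Otimes>s\<in>S. s [^] k s)"
    using assms(2) by (intro finprod_multf) auto
  ultimately show ?case
    by (intro exI[of _ "\<lambda>s. m s + k s"]) simp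
qed

text \<open>
  The step that drives the existence of a basis: a non-trivial relation between generators of
  prime power order allows one of them, $a$, to be replaced by an element $b$ whose order is a
  smaller power of the same prime, without losing $a$ from the generated subgroup.

  Raising the relation to a power that is prime to $p$ removes all the generators whose order is
  not a power of $p$, so that it becomes $\prod s^{n_s} = 1$ with all orders powers of $p$. Let $a$
  be a factor $a^{n_a} \neq 1$ whose exponent has the least $p$-adic valuation $e$, and write
  $n_s = c_s p^e$. Then $b = \prod s^{c_s}$ satisfies $b^{p^e} = 1$, whereas $a^{p^e} \neq 1$. As $p$
  does not divide $c_a$, the element $a$ is a power of $a^{c_a}$, which is a product of $b$ and powers
  of the other generators.
\<close>

lemma relation_exchange:
  fixes m :: "'a \<Rightarrow> int"
  assumes fin: "finite S" and S: "S \<subseteq> carrier G" and pp: "\<And>s. s \<in> S \<Longrightarrow> primepow (ord s)"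
    and rel: "(\<Otimes>s\<in>S. s [^] m s) = \<one>" and nontriv: "t \<in> S" "t [^] m t \<noteq> \<one>"
  obtains p e a b where "Factorial_Ring.prime p" "a \<in> S" "b \<in> carrier G" "ord b dvd p ^ e" "ord b < ord a"
    "a \<in> generate G (insert b (S - {a}))"
proof -
  obtain p k where p: "Factorial_Ring.prime p" and k: "ord t = p ^ k"
    using pp[OF nontriv(1)] by (auto simp: primepow_def)
  define T where "T = {s \<in> S. \<exists>j. ord s = p ^ j}"
  \<comment> \<open>the exponent that kills the part of the relation outside the $p$-primary component\<close>
  define N where "N = int (\<Prod>s\<in>S - T. ord s)"
  define U where "U = {s \<in> T. s [^] (m s * N) \<noteq> \<one>}"
  have cop: "coprime (int p) N"
  proof -
    have "coprime p (ord s)" if s: "s \<in> S - T" for s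
    proof -
      obtain p' j where "Factorial_Ring.prime p'" "j > 0" "ord s = p' ^ j"
        using pp[of s] s by (auto simp: primepow_def)
      moreover have "p \<noteq> p'"
        using s calculation by (auto simp: T_def)
      ultimately show ?thesis
        using p by (simp add: primes_coprime)
    qed
    then show ?thesis
      unfolding N_def coprime_int_iff by (intro prod_coprime_right)
  qed
  have dvdN: "int (ord s) dvd N" if "s \<in> S - T" for s
    unfolding N_def using that fin by (simp add: dvd_prod_eqI del: of_nat_prod)
  have UT: "U \<subseteq> T" and TS: "T \<subseteq> S"
    by (auto simp: U_def T_def)
  have finU: "finite U"
    using UT TS fin by (blast intro: finite_subset)
  have relU: "(\<Otimes>s\<in>U. s [^] (m s * N)) = \<one>"
  proof -
    have "\<one> = (\<Otimes>s\<in>S. s [^] m s) [^] N"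
      by (simp add: rel)
    also have "\<dots> = (\<Otimes>s\<in>S. (s [^] m s) [^] N)"
      using S by (intro finprod_int_pow) auto
    also have "\<dots> = (\<Otimes>s\<in>U. s [^] (m s * N))"
    proof (rule finprod_mono_neutral_cong_right[OF fin])
      show "(s [^] m s) [^] N = \<one>" if "s \<in> S - U" for s
      proof (cases "s \<in> T")
        case True
        then show ?thesis
          using that S by (auto simp: U_def int_pow_pow)
      next
        case False
        then show ?thesis
          using that S dvdN[of s] by (auto simp: int_pow_pow int_pow_eq_id)
      qed
    qed (use S UT TS in \<open>auto simp: int_pow_pow subset_iff\<close>)
    finally show ?thesis by simp
  qed
  have "t \<in> T"
    using nontriv(1) k by (auto simp: T_def)
  moreover have "t [^] (m t * N) \<noteq> \<one>"
  proof
    assume "t [^] (m t * N) = \<one>"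
    then have "int p ^ k dvd m t * N"
      using S nontriv(1) k by (auto simp: int_pow_eq_id)
    moreover have "coprime (int p ^ k) N"
      using cop by simp
    ultimately have "int (ord t) dvd m t"
      using k by (simp add: coprime_dvd_mult_left_iff)
    then show False
      using nontriv S by (auto simp: int_pow_eq_id)
  qed
  ultimately have "t \<in> U"
    by (auto simp: U_def)
  \<comment> \<open>this is the $p$-adic valuation, because the exponents of the factors in \<open>U\<close> are non-zero\<close>
  define e where "e s = multiplicity (int p) (m s * N)" for s
  obtain a where a: "a \<in> U" and amin: "\<And>s. s \<in> U \<Longrightarrow> e a \<le> e s"
    using ex_has_least_nat[of "\<lambda>s. s \<in> U" t e] \<open>t \<in> U\<close> by blast
  have nz: "m s * N \<noteq> 0" if "s \<in> U" for s
    using that by (auto simp: U_def)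
  define c where "c s = m s * N div int p ^ e a" for s
  have c: "m s * N = c s * int p ^ e a" if "s \<in> U" for s
    using multiplicity_dvd'[of "e a" "int p" "m s * N"] amin[OF that]
    by (simp add: c_def e_def)
  define b where "b = (\<Otimes>s\<in>U. s [^] c s)"
  have US: "U \<subseteq> carrier G" and aS: "a \<in> S" and aC: "a \<in> carrier G"
    using UT TS S a by auto
  have bC: "b \<in> carrier G"
    unfolding b_def using US by (intro finprod_closed) auto
  have "b [^] (int p ^ e a) = (\<Otimes>s\<in>U. (s [^] c s) [^] (int p ^ e a))"
    unfolding b_def using US by (intro finprod_int_pow) auto
  also have "\<dots> = (\<Otimes>s\<in>U. s [^] (m s * N))"
    using US c by (intro finprod_cong') (auto simp: int_pow_pow)
  finally have "b [^] (int p ^ e a) = \<one>"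
    using relU by simp
  then have "int (ord b) dvd int (p ^ e a)"
    using bC by (simp add: int_pow_eq_id)
  then have ordb: "ord b dvd p ^ e a"
    by (simp only: int_dvd_int_iff)
  obtain j where j: "ord a = p ^ j"
    using a UT by (auto simp: T_def)
  have "\<not> int (p ^ j) dvd m a * N"
    using a aC j by (auto simp: U_def int_pow_eq_id)
  moreover have "int (p ^ j) dvd m a * N" if "j \<le> e a"
    unfolding c[OF a] using that by (simp add: le_imp_power_dvd)
  ultimately have "e a < j"
    by (meson not_le)
  then have "p ^ e a < ord a"
    unfolding j by (rule power_strict_increasing[OF _ prime_gt_1_nat[OF p]])
  moreover have "ord b \<le> p ^ e a"
    using ordb p by (intro dvd_imp_le) (auto simp: prime_gt_0_nat)
  ultimately have less: "ord b < ord a"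
    by simp
  \<comment> \<open>the exponent of \<open>a\<close> in \<open>b\<close> is invertible modulo the order of \<open>a\<close>\<close>
  have "\<not> int p dvd c a"
  proof
    assume "int p dvd c a"
    then have "int p ^ Suc (e a) dvd m a * N"
      using c[OF a] by (simp add: mult_dvd_mono)
    then have "Suc (e a) \<le> e a"
      unfolding e_def using p nz[OF a] by (intro multiplicity_geI) auto
    then show False by simp
  qed
  then have "coprime (int (ord a)) (c a)"
    using p j by (simp add: prime_imp_coprime)
  then obtain u v where uv: "u * int (ord a) + v * c a = 1"
    by (metis bezout_int coprime_imp_gcd_eq_1)
  let ?H = "generate G (insert b (S - {a}))"
  have sub: "subgroup ?H G"
    using S bC by (intro generate_is_subgroup) auto
  have "(\<Otimes>s\<in>U - {a}. s [^] c s) \<in> ?H"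
    using UT TS by (intro finprod_mem_subgroup[OF sub] subgroup_int_pow_closed[OF sub] generate.incl) auto
  moreover have "b \<in> ?H"
    by (intro generate.incl) auto
  moreover have "b = a [^] c a \<otimes> (\<Otimes>s\<in>U - {a}. s [^] c s)"
    unfolding b_def using finprod_insert[of "U - {a}" a "\<lambda>s. s [^] c s"] finU US aC a
    by (auto simp: insert_absorb)
  then have "a [^] c a = b \<otimes> inv (\<Otimes>s\<in>U - {a}. s [^] c s)"
    using US aC bC by (intro inv_solve_right[THEN iffD2]) (auto intro!: finprod_closed)
  ultimately have "a [^] c a \<in> ?H"
    using sub by (simp add: subgroup.m_closed subgroup.m_inv_closed)
  then have "(a [^] c a) [^] v \<in> ?H"
    by (rule subgroup_int_pow_closed[OF sub])
  moreover have "(a [^] c a) [^] v = a [^] (int (ord a) * u + c a * v)"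
    using aC by (simp add: int_pow_mult int_pow_pow[symmetric] int_pow_int)
  ultimately have "a \<in> ?H"
    using uv aC by (simp add: mult.commute)
  then show thesis
    by (rule that[OF p aS bC ordb less])
qed

text \<open>
  The fundamental theorem of finite abelian groups, in the form of a basis: each element has
  unique coordinates modulo the orders of the basis elements. The basis is a generating set that
  minimises the sum of the orders. The exchange lemma may return the neutral element as the
  replacement; it is then dropped, which decreases the sum as well.
\<close>

theorem finite_comm_group_basis:
  assumes fin: "finite (carrier G)"
  obtains S where "S \<subseteq> carrier G" "\<forall>s\<in>S. primepow (ord s)"
    "bij_betw (\<lambda>m. \<Otimes>s\<in>S. s [^] m s) (\<Pi>\<^sub>E s\<in>S. {0..<int (ord s)}) (carrier G)"
proof -
  define gen where "gen S \<longleftrightarrow> S \<subseteq> {x \<in> carrier G. primepow (ord x)} \<and> generate G S = carrier G" for S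
  have "gen {x \<in> carrier G. primepow (ord x)}"
    using generate_primepow_ord[OF fin] by (simp add: gen_def)
  then obtain S where gen: "gen S" and min: "\<And>S'. gen S' \<Longrightarrow> sum ord S \<le> sum ord S'"
    using ex_has_least_nat[of gen _ "sum ord"] by blast
  have S: "S \<subseteq> carrier G" and pp: "\<And>s. s \<in> S \<Longrightarrow> primepow (ord s)" and genS: "generate G S = carrier G"
    using gen by (auto simp: gen_def)
  have finS: "finite S"
    using S fin by (rule finite_subset)
  have indep: "s [^] m s = \<one>" if rel: "(\<Otimes>s\<in>S. s [^] m s) = \<one>" and "s \<in> S" for m :: "'a \<Rightarrow> int" and s
  proof (rule ccontr)
    assume nontriv: "s [^] m s \<noteq> \<one>"
    obtain p e a b where *: "Factorial_Ring.prime p" "a \<in> S" "b \<in> carrier G" "ord b dvd p ^ e" "ord b < ord a"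
      "a \<in> generate G (insert b (S - {a}))"
      by (rule relation_exchange[where m = m, OF finS S pp rel \<open>s \<in> S\<close> nontriv])
    define S' where "S' = (if b = \<one> then {} else {b}) \<union> (S - {a})"
    have "primepow (ord b)" if "b \<noteq> \<one>"
    proof -
      obtain j where "ord b = p ^ j"
        using *(1,4) by (auto simp: divides_primepow_nat)
      then show ?thesis
        using that *(1,3) ord_eq_1[of b] by (cases "j = 0") auto
    qed
    then have S': "S' \<subseteq> {x \<in> carrier G. primepow (ord x)}"
      using S pp *(3) by (auto simp: S'_def)
    then have sub: "subgroup (generate G S') G"
      by (intro generate_is_subgroup) auto
    have "insert b (S - {a}) \<subseteq> generate G S'"
      by (auto simp: S'_def intro: generate.incl generate.one)
    then have "generate G (insert b (S - {a})) \<subseteq> generate G S'"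
      using sub by (rule generate_subgroup_incl)
    then have "S \<subseteq> generate G S'"
      using *(6) by (auto simp: S'_def intro: generate.incl)
    then have "carrier G \<subseteq> generate G S'"
      using generate_subgroup_incl[OF \<open>S \<subseteq> generate G S'\<close> sub] genS by simp
    then have "gen S'"
      using S' subgroup.subset[OF sub] by (auto simp: gen_def)
    moreover have "sum ord S' < sum ord S"
    proof -
      have "sum ord S' \<le> sum ord (if b = \<one> then {} else {b}) + sum ord (S - {a})"
        unfolding S'_def using finS by (simp add: sum_Un_nat)
      also have "\<dots> \<le> ord b + sum ord (S - {a})"
        by simp
      also have "\<dots> < ord a + sum ord (S - {a})"
        using *(5) by simp
      also have "\<dots> = sum ord S"
        using finS *(2) by (simp add: sum.remove)
      finally show ?thesis .
    qed
    ultimately show False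
      using min[of S'] by simp
  qed
  have pos: "ord s > 0" if "s \<in> S" for s
    using pp[OF that] by (rule primepow_gt_0_nat)
  have "bij_betw (\<lambda>m. \<Otimes>s\<in>S. s [^] m s) (\<Pi>\<^sub>E s\<in>S. {0..<int (ord s)}) (carrier G)"
    unfolding bij_betw_def
  proof
    show "inj_on (\<lambda>m. \<Otimes>s\<in>S. s [^] m s) (\<Pi>\<^sub>E s\<in>S. {0..<int (ord s)})"
    proof (rule inj_onI)
      fix m k :: "'a \<Rightarrow> int"
      assume mk: "m \<in> (\<Pi>\<^sub>E s\<in>S. {0..<int (ord s)})" "k \<in> (\<Pi>\<^sub>E s\<in>S. {0..<int (ord s)})"
        and eq: "(\<Otimes>s\<in>S. s [^] m s) = (\<Otimes>s\<in>S. s [^] k s)"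
      have "(\<Otimes>s\<in>S. s [^] (m s - k s)) \<otimes> (\<Otimes>s\<in>S. s [^] k s) = (\<Otimes>s\<in>S. s [^] (m s - k s) \<otimes> s [^] k s)"
        using S by (intro finprod_multf[symmetric]) auto
      also have "\<dots> = (\<Otimes>s\<in>S. s [^] m s)"
        using S by (intro finprod_cong') (auto simp: int_pow_mult[symmetric])
      finally have rel: "(\<Otimes>s\<in>S. s [^] (m s - k s)) = \<one>"
        unfolding eq using S by (subst (asm) r_cancel_one) (auto intro!: finprod_closed)
      have "m s = k s" if s: "s \<in> S" for s
      proof -
        have "s [^] (m s - k s) = \<one>"
          by (rule indep[of "\<lambda>s. m s - k s"]) (fact rel, fact s)
        moreover have "s \<in> carrier G"
          using s S by blast
        ultimately have "m s mod int (ord s) = k s mod int (ord s)"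
          by (simp add: int_pow_eq_id mod_eq_dvd_iff)
        moreover have "m s \<in> {0..<int (ord s)}" "k s \<in> {0..<int (ord s)}"
          using mk[THEN PiE_mem, OF s] .
        ultimately show ?thesis
          by simp
      qed
      then show "m = k"
        using mk by (intro PiE_ext)
    qed
    show "(\<lambda>m. \<Otimes>s\<in>S. s [^] m s) ` (\<Pi>\<^sub>E s\<in>S. {0..<int (ord s)}) = carrier G"
    proof (intro equalityI subsetI)
      fix x assume "x \<in> carrier G"
      then obtain m :: "'a \<Rightarrow> int" where m: "x = (\<Otimes>s\<in>S. s [^] m s)"
        using generate_eq_finprod[OF finS S] genS by blast
      have "x = (\<Otimes>s\<in>S. s [^] (\<lambda>s\<in>S. m s mod int (ord s)) s)"
        unfolding m using S by (intro finprod_cong') (auto simp: int_pow_eq mod_eq_dvd_iff[symmetric])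
      moreover have "(\<lambda>s\<in>S. m s mod int (ord s)) \<in> (\<Pi>\<^sub>E s\<in>S. {0..<int (ord s)})"
        using pos by auto
      ultimately show "x \<in> (\<lambda>m. \<Otimes>s\<in>S. s [^] m s) ` (\<Pi>\<^sub>E s\<in>S. {0..<int (ord s)})"
        by blast
    next
      fix x assume "x \<in> (\<lambda>m. \<Otimes>s\<in>S. s [^] m s) ` (\<Pi>\<^sub>E s\<in>S. {0..<int (ord s)})"
      then obtain m :: "'a \<Rightarrow> int" where "x = (\<Otimes>s\<in>S. s [^] m s)"
        by blast
      moreover have "(\<lambda>s. s [^] m s) \<in> S \<rightarrow> carrier G"
        using S by auto
      ultimately show "x \<in> carrier G"
        by simp
    qed
  qed
  then show thesis
    using that[of S] S pp by simp
qed

end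

section \<open>Constructions on quandles and cores of abelian groups\<close>

text \<open>
  A surjective self-map of a finite set is injective, so the neutral element is the only one whose
  square is neutral; an element of order $2j$ would give $x^j$ as a second one.
\<close>

lemma (in group) odd_ord_of_squares_surj:
  assumes "finite (carrier G)" "carrier G \<subseteq> (\<lambda>x. x \<otimes> x) ` carrier G" "x \<in> carrier G"
  shows "odd (ord x)"
proof
  assume "even (ord x)"
  then obtain j where j: "ord x = 2 * j"
    by (elim evenE)
  have inj: "inj_on (\<lambda>x. x \<otimes> x) (carrier G)"
    using assms(1,2) by (rule finite_surj_inj)
  have "x [^] j \<otimes> x [^] j = \<one> \<otimes> \<one>"
    using assms(3) j by (metis mult_2 nat_pow_mult l_one one_closed pow_ord_eq_1)
  then have "x [^] j = \<one>"
    using inj_onD[OF inj, of "x [^] j" \<one>] assms(3) by simp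
  then have "ord x dvd j"
    using assms(3) by (simp add: pow_eq_id)
  moreover have "ord x \<ge> 1"
    using assms(1,3) by (rule ord_ge_1)
  ultimately show False
    using j by (auto dest: dvd_imp_le)
qed

lemma quandle_isomorphic_sym:
  assumes "quandle Q" "quandle_isomorphic Q R"
  shows "quandle_isomorphic R Q"
proof -
  obtain f where f: "f \<in> quandle_hom Q R" and bij: "bij_betw f (carrier Q) (carrier R)"
    using assms(2) by (auto simp: quandle_isomorphic_def)
  let ?g = "inv_into (carrier Q) f"
  have "?g (smap R x y) = smap Q (?g x) (?g y)" if "x \<in> carrier R" "y \<in> carrier R" for x y
  proof -
    have g: "?g x \<in> carrier Q" "?g y \<in> carrier Q"
      using bij_betwE[OF bij_betw_inv_into[OF bij]] that by auto
    then have "smap Q (?g x) (?g y) \<in> carrier Q"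
      using quandle.Q2[OF assms(1)] by (blast dest: bij_betwE)
    moreover have "f (smap Q (?g x) (?g y)) = smap R x y"
      using f g that bij by (simp add: quandle_hom_def bij_betw_inv_into_right)
    ultimately show ?thesis
      using bij by (metis bij_betw_inv_into_left)
  qed
  then have "?g \<in> quandle_hom R Q"
    using bij_betwE[OF bij_betw_inv_into[OF bij]] by (auto simp: quandle_hom_def)
  then show ?thesis
    using bij_betw_inv_into[OF bij] by (auto simp: quandle_isomorphic_def)
qed

lemma quandle_isomorphic_trans:
  assumes "quandle_isomorphic P Q" "quandle_isomorphic Q R"
  shows "quandle_isomorphic P R"
proof -
  obtain f g where "f \<in> quandle_hom P Q" "bij_betw f (carrier P) (carrier Q)"
    "g \<in> quandle_hom Q R" "bij_betw g (carrier Q) (carrier R)"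
    using assms by (auto simp: quandle_isomorphic_def)
  then have "g \<circ> f \<in> quandle_hom P R" "bij_betw (g \<circ> f) (carrier P) (carrier R)"
    by (auto simp: quandle_hom_def Pi_iff intro: bij_betw_trans)
  then show ?thesis
    by (auto simp: quandle_isomorphic_def)
qed

lemma quandle_prod_reindex:
  assumes "bij_betw b I J"
  shows "quandle_isomorphic (quandle_prod J Q) (quandle_prod I (Q \<circ> b))"
proof -
  define c where "c = inv_into I b"
  let ?f = "\<lambda>x. \<lambda>i\<in>I. x (b i)"
  let ?g = "\<lambda>y. \<lambda>j\<in>J. y (c j)"
  have b: "\<And>i. i \<in> I \<Longrightarrow> b i \<in> J" "\<And>i. i \<in> I \<Longrightarrow> c (b i) = i"
    using assms by (auto simp: c_def bij_betw_inv_into_left dest: bij_betwE)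
  have c: "\<And>j. j \<in> J \<Longrightarrow> c j \<in> I" "\<And>j. j \<in> J \<Longrightarrow> b (c j) = j"
    using assms by (auto simp: c_def bij_betw_inv_into_right dest: bij_betw_inv_into bij_betwE)
  have f: "?f \<in> carrier (quandle_prod J Q) \<rightarrow> carrier (quandle_prod I (Q \<circ> b))"
    using b by (auto simp: quandle_prod_def)
  then have "?f \<in> quandle_hom (quandle_prod J Q) (quandle_prod I (Q \<circ> b))"
    using b by (simp add: quandle_hom_def quandle_prod_def cong: restrict_cong)
  moreover have "bij_betw ?f (carrier (quandle_prod J Q)) (carrier (quandle_prod I (Q \<circ> b)))"
  proof (rule bij_betwI[where g = ?g])
    show "?g \<in> carrier (quandle_prod I (Q \<circ> b)) \<rightarrow> carrier (quandle_prod J Q)"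
    proof
      fix y assume y: "y \<in> carrier (quandle_prod I (Q \<circ> b))"
      have "y (c j) \<in> carrier (Q j)" if "j \<in> J" for j
        using y c[OF that] by (auto simp: quandle_prod_def PiE_iff dest!: bspec[of _ _ "c j"])
      then show "?g y \<in> carrier (quandle_prod J Q)"
        by (simp add: quandle_prod_def)
    qed
    show "?g (?f x) = x" if "x \<in> carrier (quandle_prod J Q)" for x
      using that c by (auto simp: quandle_prod_def fun_eq_iff PiE_iff extensional_def)
    show "?f (?g y) = y" if "y \<in> carrier (quandle_prod I (Q \<circ> b))" for y
      using that b by (auto simp: quandle_prod_def fun_eq_iff PiE_iff extensional_def)
  qed (rule f)
  ultimately show ?thesis
    unfolding quandle_isomorphic_def by (intro bexI)
qed

text \<open>
  The core of a group. For an abelian group, written additively, the operation is $2x - y$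
  (the Takasaki quandle), so that dihedral quandles are the cores of cyclic groups.
\<close>

definition core_quandle :: "('a, 'b) monoid_scheme \<Rightarrow> 'a quandle" where
  "core_quandle G =
     \<lparr>carrier = carrier G, smap = (\<lambda>x y. x \<otimes>\<^bsub>G\<^esub> inv\<^bsub>G\<^esub> y \<otimes>\<^bsub>G\<^esub> x)\<rparr>"

text \<open>
  In the coordinates given by a basis the operation $x y^{-1} x$ becomes $2x - y$ in each
  coordinate. The orders of the basis elements are odd because squaring is onto.
\<close>

theorem (in comm_group) core_quandle_decomposition:
  assumes fin: "finite (carrier G)" and surj: "carrier G \<subseteq> (\<lambda>x. x \<otimes> x) ` carrier G"
  obtains n :: nat and q :: "nat \<Rightarrow> nat" where "\<And>i. i < n \<Longrightarrow> odd (q i) \<and> primepow (q i)"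
    "quandle_isomorphic (quandle_prod {..<n} (\<lambda>i. dihedral_quandle (q i))) (core_quandle G)"
proof -
  obtain S where S: "S \<subseteq> carrier G" and pp: "\<forall>s\<in>S. primepow (ord s)"
    and bij: "bij_betw (\<lambda>m. \<Otimes>s\<in>S. s [^] m s) (\<Pi>\<^sub>E s\<in>S. {0..<int (ord s)}) (carrier G)"
    by (rule finite_comm_group_basis[OF fin])
  let ?P = "quandle_prod S (\<lambda>s. dihedral_quandle (ord s))"
  let ?F = "\<lambda>m :: 'a \<Rightarrow> int. \<Otimes>s\<in>S. s [^] m s"
  have pow: "(\<lambda>s. s [^] m s) \<in> S \<rightarrow> carrier G" for m :: "'a \<Rightarrow> int"
    using S by auto
  have hom: "?F (smap ?P x y) = ?F x \<otimes> inv ?F y \<otimes> ?F x" for x y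
  proof -
    have "?F (smap ?P x y) = (\<Otimes>s\<in>S. s [^] x s \<otimes> (s [^] y s) [^] (- 1 :: int) \<otimes> s [^] x s)"
    proof (rule finprod_cong')
      fix s assume s: "s \<in> S"
      then have sC: "s \<in> carrier G"
        using S by blast
      have "s [^] smap ?P x y s = s [^] (x s + y s * - 1 + x s)"
        using s sC by (simp add: quandle_prod_def dihedral_quandle_def int_pow_eq mod_eq_dvd_iff[symmetric])
      also have "\<dots> = s [^] x s \<otimes> (s [^] y s) [^] (- 1 :: int) \<otimes> s [^] x s"
        using sC by (simp only: int_pow_mult int_pow_pow)
      finally show "s [^] smap ?P x y s = s [^] x s \<otimes> (s [^] y s) [^] (- 1 :: int) \<otimes> s [^] x s" .
    qed (use S in auto)
    also have "\<dots> = (\<Otimes>s\<in>S. s [^] x s \<otimes> (s [^] y s) [^] (- 1 :: int)) \<otimes> ?F x"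
      using S by (intro finprod_multf) auto
    also have "(\<Otimes>s\<in>S. s [^] x s \<otimes> (s [^] y s) [^] (- 1 :: int)) = ?F x \<otimes> (\<Otimes>s\<in>S. (s [^] y s) [^] (- 1 :: int))"
      using S by (intro finprod_multf) auto
    also have "(\<Otimes>s\<in>S. (s [^] y s) [^] (- 1 :: int)) = ?F y [^] (- 1 :: int)"
      by (rule finprod_int_pow[OF pow, symmetric])
    also have "\<dots> = inv ?F y"
      using finprod_closed[OF pow[of y]] by (simp add: int_pow_neg)
    finally show ?thesis .
  qed
  have iso: "quandle_isomorphic ?P (core_quandle G)"
    unfolding quandle_isomorphic_def
  proof
    have "?F m \<in> carrier G" for m
      using pow by (rule finprod_closed)
    then show "?F \<in> quandle_hom ?P (core_quandle G)"
      unfolding quandle_hom_def by (simp add: core_quandle_def hom)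
    show "bij_betw ?F (carrier ?P) (carrier (core_quandle G))"
      using bij by (simp add: quandle_prod_def dihedral_quandle_def core_quandle_def)
  qed
  obtain b where b: "bij_betw b {..<card S} S"
    using ex_bij_betw_nat_finite[OF finite_subset[OF S fin]] by (auto simp: atLeast0LessThan)
  then have "quandle_isomorphic ?P (quandle_prod {..<card S} ((\<lambda>s. dihedral_quandle (ord s)) \<circ> b))"
    by (rule quandle_prod_reindex)
  then have "quandle_isomorphic (quandle_prod {..<card S} (\<lambda>i. dihedral_quandle (ord (b i)))) ?P"
    unfolding comp_def
    by (rule quandle_isomorphic_sym[OF quandle_quandle_prod[OF quandle_dihedral_quandle]])
  then have "quandle_isomorphic (quandle_prod {..<card S} (\<lambda>i. dihedral_quandle (ord (b i)))) (core_quandle G)"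
    using iso by (rule quandle_isomorphic_trans)
  moreover have "odd (ord (b i)) \<and> primepow (ord (b i))" if "i < card S" for i
  proof -
    have "b i \<in> S"
      using bij_betwE[OF b] that by simp
    then show ?thesis
      using S pp odd_ord_of_squares_surj[OF fin surj, of "b i"] by auto
  qed
  ultimately show thesis
    using that[of "card S" "\<lambda>i. ord (b i)"] by simp
qed

text \<open>
  Centralisers are subgroups. Hence the generated subgroup lies in the centraliser of the
  generators, and by symmetry also in the centraliser of itself.
\<close>

lemma (in group) comm_group_subgroup_generated:
  assumes S: "S \<subseteq> carrier G" and comm: "\<And>x y. x \<in> S \<Longrightarrow> y \<in> S \<Longrightarrow> x \<otimes> y = y \<otimes> x"
  shows "comm_group (subgroup_generated G S)"
proof -
  define Z where "Z T = {g \<in> carrier G. \<forall>h\<in>T. g \<otimes> h = h \<otimes> g}" for T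
  have Z: "subgroup (Z T) G" if T: "T \<subseteq> carrier G" for T
  proof (rule subgroupI)
    have "\<one> \<in> Z T"
      using T by (auto simp: Z_def)
    then show "Z T \<noteq> {}"
      by blast
    show "inv g \<in> Z T" if g: "g \<in> Z T" for g
    proof -
      have "inv g \<otimes> h = h \<otimes> inv g" if "h \<in> T" for h
      proof -
        have gh: "g \<in> carrier G" "h \<in> carrier G" "g \<otimes> h = h \<otimes> g"
          using g T that by (auto simp: Z_def)
        then have "h = g \<otimes> (h \<otimes> inv g)"
          by (simp add: m_assoc[symmetric]) (simp add: m_assoc)
        then show ?thesis
          using gh(1,2) inv_solve_left[of "h \<otimes> inv g" g h] by simp
      qed
      then show ?thesis
        using g by (auto simp: Z_def)
    qed
    show "g \<otimes> g' \<in> Z T" if "g \<in> Z T" "g' \<in> Z T" for g g'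
    proof -
      have "g \<otimes> g' \<otimes> h = h \<otimes> (g \<otimes> g')" if "h \<in> T" for h
      proof -
        have "g \<in> carrier G" "g' \<in> carrier G" "h \<in> carrier G" "g \<otimes> h = h \<otimes> g" "g' \<otimes> h = h \<otimes> g'"
          using \<open>g \<in> Z T\<close> \<open>g' \<in> Z T\<close> T that by (auto simp: Z_def)
        then show ?thesis
          by (metis m_assoc)
      qed
      then show ?thesis
        using that by (auto simp: Z_def)
    qed
  qed (use T in \<open>auto simp: Z_def\<close>)
  have "generate G S \<subseteq> Z S"
    using S comm by (intro generate_subgroup_incl Z) (auto simp: Z_def)
  then have "S \<subseteq> Z (generate G S)"
    using S by (auto simp: Z_def)
  then have "generate G S \<subseteq> Z (generate G S)"
    by (rule generate_subgroup_incl[OF _ Z[OF generate_incl[OF S]]])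
  then have "x \<otimes> y = y \<otimes> x" if "x \<in> generate G S" "y \<in> generate G S" for x y
    using that by (auto simp: Z_def)
  then show ?thesis
    using S by (intro group.group_comm_groupI group_subgroup_generated)
      (simp_all add: carrier_subgroup_generated Int_absorb1)
qed

section \<open>The displacement group\<close>

text \<open>
  These lemmas replace computations in the group of permutations by computations with the values
  of permutations at points.
\<close>

lemma BijGroup_mult_apply:
  assumes "g \<in> carrier (BijGroup S)" "h \<in> carrier (BijGroup S)" "x \<in> S"
  shows "(g \<otimes>\<^bsub>BijGroup S\<^esub> h) x = g (h x)"
  using assms by (simp add: BijGroup_def compose_eq)

lemma BijGroup_apply_closed:
  assumes "g \<in> carrier (BijGroup S)" "x \<in> S"
  shows "g x \<in> S"
  using assms Bij_imp_funcset by (fastforce simp: BijGroup_def)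

lemma BijGroup_inv_apply:
  assumes "g \<in> carrier (BijGroup S)" "x \<in> S"
  shows "(inv\<^bsub>BijGroup S\<^esub> g) (g x) = x" "g ((inv\<^bsub>BijGroup S\<^esub> g) x) = x"
proof -
  interpret group "BijGroup S"
    by (rule group_BijGroup)
  have "\<one>\<^bsub>BijGroup S\<^esub> x = x"
    using assms(2) by (simp add: BijGroup_def)
  then show "(inv\<^bsub>BijGroup S\<^esub> g) (g x) = x" "g ((inv\<^bsub>BijGroup S\<^esub> g) x) = x"
    using assms BijGroup_mult_apply[of "inv\<^bsub>BijGroup S\<^esub> g" S g x]
      BijGroup_mult_apply[of g S "inv\<^bsub>BijGroup S\<^esub> g" x] by auto
qed

lemma BijGroup_eqI:
  assumes "g \<in> carrier (BijGroup S)" "h \<in> carrier (BijGroup S)" "\<And>x. x \<in> S \<Longrightarrow> g x = h x"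
  shows "g = h"
  using assms by (intro extensionalityI[of _ S]) (auto simp: BijGroup_def Bij_imp_extensional)

context quandle
begin

abbreviation perm_group where "perm_group \<equiv> BijGroup (carrier Q)"

abbreviation displacements where "displacements \<equiv> carrier (displacement_group Q)"

definition displacement_gens where
  "displacement_gens = {sperm Q x \<otimes>\<^bsub>perm_group\<^esub> sperm Q y | x y. x \<in> carrier Q \<and> y \<in> carrier Q}"

lemma group_perm_group: "group perm_group"
  by (rule group_BijGroup)

lemma smap_closed [simp]: "x \<in> carrier Q \<Longrightarrow> y \<in> carrier Q \<Longrightarrow> smap Q x y \<in> carrier Q"
  using Q2 by (blast dest: bij_betwE)

lemma sperm_apply [simp]: "y \<in> carrier Q \<Longrightarrow> sperm Q x y = smap Q x y"
  by (simp add: sperm_def)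

lemma displacement_gens_subset: "displacement_gens \<subseteq> carrier perm_group"
  using sperm_in_BijGroup group.is_monoid[OF group_perm_group]
  by (auto simp: displacement_gens_def intro: monoid.m_closed)

lemma displacement_group_eq: "displacement_group Q = subgroup_generated perm_group displacement_gens"
  by (simp add: displacement_group_def displacement_gens_def)

lemma displacements_eq: "displacements = generate perm_group displacement_gens"
  using displacement_gens_subset by (simp add: displacement_group_eq carrier_subgroup_generated Int_absorb1)

lemma subgroup_displacements: "subgroup displacements perm_group"
  unfolding displacements_eq by (rule group.generate_is_subgroup[OF group_perm_group displacement_gens_subset])

lemma displacements_in_perm_group: "g \<in> displacements \<Longrightarrow> g \<in> carrier perm_group"
  using subgroup.subset[OF subgroup_displacements] by blast

lemma displacement_closed [simp]: "g \<in> displacements \<Longrightarrow> x \<in> carrier Q \<Longrightarrow> g x \<in> carrier Q"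
  by (rule BijGroup_apply_closed[OF displacements_in_perm_group])

lemma mult_displacement_group [simp]:
  "monoid.mult (displacement_group Q) = monoid.mult perm_group"
  by (simp add: displacement_group_eq)

lemma inv_displacement_group [simp]:
  "g \<in> displacements \<Longrightarrow> inv\<^bsub>displacement_group Q\<^esub> g = inv\<^bsub>perm_group\<^esub> g"
  using group.inv_subgroup_generated[OF group_perm_group] by (simp add: displacement_group_eq)

lemma displacement_mult:
  assumes "g \<in> displacements" "h \<in> displacements"
  shows "g \<otimes>\<^bsub>perm_group\<^esub> h \<in> displacements"
    and "x \<in> carrier Q \<Longrightarrow> (g \<otimes>\<^bsub>perm_group\<^esub> h) x = g (h x)"
  using subgroup.m_closed[OF subgroup_displacements assms]
    BijGroup_mult_apply[OF assms[THEN displacements_in_perm_group]] by simp_all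

lemma displacement_inv:
  assumes "g \<in> displacements"
  shows "inv\<^bsub>perm_group\<^esub> g \<in> displacements"
    and "x \<in> carrier Q \<Longrightarrow> (inv\<^bsub>perm_group\<^esub> g) (g x) = x"
    and "x \<in> carrier Q \<Longrightarrow> g ((inv\<^bsub>perm_group\<^esub> g) x) = x"
  using subgroup.m_inv_closed[OF subgroup_displacements assms]
    BijGroup_inv_apply[OF displacements_in_perm_group[OF assms]] by simp_all

lemma displacement_gen:
  assumes "x \<in> carrier Q" "y \<in> carrier Q"
  obtains g where "g \<in> displacements" "\<forall>z\<in>carrier Q. g z = smap Q x (smap Q y z)"
proof
  show "sperm Q x \<otimes>\<^bsub>perm_group\<^esub> sperm Q y \<in> displacements"
    unfolding displacements_eq using assms by (intro generate.incl) (auto simp: displacement_gens_def)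
  show "\<forall>z\<in>carrier Q. (sperm Q x \<otimes>\<^bsub>perm_group\<^esub> sperm Q y) z = smap Q x (smap Q y z)"
    using assms by (simp add: BijGroup_mult_apply sperm_in_BijGroup)
qed

text \<open>
  Induction over the generation of the displacement group, in terms of values at points. The
  hypotheses include that the elements to which the induction has come are displacements, so that
  properties that depend on commutativity can be proved.
\<close>

lemma displacements_induct [consumes 1, case_names one gen mult inv]:
  assumes "g \<in> displacements"
    and one: "P \<one>\<^bsub>perm_group\<^esub>"
    and gen: "\<And>g x y. \<lbrakk>g \<in> displacements; x \<in> carrier Q; y \<in> carrier Q;
        \<And>z. z \<in> carrier Q \<Longrightarrow> g z = smap Q x (smap Q y z)\<rbrakk> \<Longrightarrow> P g"
    and mult: "\<And>g h. \<lbrakk>g \<in> displacements; h \<in> displacements; P g; P h\<rbrakk> \<Longrightarrow> P (g \<otimes>\<^bsub>perm_group\<^esub> h)"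
    and inv: "\<And>g. \<lbrakk>g \<in> displacements; P g\<rbrakk> \<Longrightarrow> P (inv\<^bsub>perm_group\<^esub> g)"
  shows "P g"
proof -
  have P: "P g \<and> g \<in> displacements" if g: "g \<in> displacement_gens" for g
  proof -
    obtain x y where xy: "x \<in> carrier Q" "y \<in> carrier Q" "g = sperm Q x \<otimes>\<^bsub>perm_group\<^esub> sperm Q y"
      using g by (auto simp: displacement_gens_def)
    have "g \<in> displacements"
      unfolding displacements_eq using g by (rule generate.incl)
    moreover have "g z = smap Q x (smap Q y z)" if "z \<in> carrier Q" for z
      using xy that by (simp add: BijGroup_mult_apply sperm_in_BijGroup)
    ultimately show ?thesis
      using gen xy(1,2) by blast
  qed
  have "g \<in> generate perm_group displacement_gens"
    using assms(1) by (simp add: displacements_eq)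
  then show ?thesis
  proof (induction g rule: generate.induct)
    case one
    show ?case by (rule assms(2))
  next
    case (incl g)
    then show ?case using P by blast
  next
    case (inv g)
    then show ?case using P assms(5) by blast
  next
    case (eng g h)
    then show ?case using mult by (simp add: displacements_eq)
  qed
qed

lemma one_apply [simp]: "x \<in> carrier Q \<Longrightarrow> \<one>\<^bsub>perm_group\<^esub> x = x"
  by (simp add: BijGroup_def)

text \<open>
  Displacements are automorphisms of the quandle, since (Q3) says so for each $s_x$.
\<close>

lemma displacement_smap:
  assumes "g \<in> displacements" "x \<in> carrier Q" "y \<in> carrier Q"
  shows "g (smap Q x y) = smap Q (g x) (g y)"
  using assms(1) assms(2,3)
proof (induction g arbitrary: x y rule: displacements_induct)
  case (gen g a b)
  then show ?case
    by (simp add: Q3[of b x y] Q3[of a "smap Q b x" "smap Q b y"])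
next
  case (mult g h)
  then show ?case
    by (simp add: displacement_mult)
next
  case (inv g)
  let ?h = "inv\<^bsub>perm_group\<^esub> g"
  have h: "?h x \<in> carrier Q" "?h y \<in> carrier Q"
    using inv by (simp_all add: displacement_inv(1))
  have eq: "smap Q x y = g (smap Q (?h x) (?h y))"
    using inv h by (simp add: displacement_inv(3))
  show ?case
    by (subst eq) (rule displacement_inv(2)[OF inv.hyps smap_closed[OF h]])
qed simp

text \<open>
  The displacement group has the same orbits as the inner automorphism group: by (Q1), a
  generator acts on the given point as $s_z(x) = s_z(s_x(x))$, that is, as a displacement that
  depends on the point.
\<close>

lemma displacements_transitive:
  assumes "quandle_connected Q" "x \<in> carrier Q" "y \<in> carrier Q"
  obtains g where "g \<in> displacements" "g x = y"
proof -
  have sub: "{sperm Q x | x. x \<in> carrier Q} \<subseteq> carrier perm_group"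
    using sperm_in_BijGroup by auto
  have tr: "\<exists>g\<in>displacements. g x = z"
    if "g \<in> displacements" "h \<in> displacements" "g x = y" "h y = z" "x \<in> carrier Q" for g h x y z
    using that displacement_mult[of h g] by (intro bexI[of _ "h \<otimes>\<^bsub>perm_group\<^esub> g"]) auto
  have step: "\<exists>h\<in>displacements. h x = smap Q z x" if "x \<in> carrier Q" "z \<in> carrier Q" for x z
    using displacement_gen[OF that(2,1)] that by (metis Q1)
  have orbit: "\<exists>h\<in>displacements. h x = g x"
    if "g \<in> generate perm_group {sperm Q x | x. x \<in> carrier Q}" "x \<in> carrier Q" for g x
    using that
  proof (induction g arbitrary: x rule: generate.induct)
    case one
    then show ?case
      by (intro bexI[of _ "\<one>\<^bsub>perm_group\<^esub>"]) (auto simp: subgroup.one_closed[OF subgroup_displacements])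
  next
    case (incl g)
    then show ?case
      using step by auto
  next
    case (inv g)
    then obtain z where z: "z \<in> carrier Q" "g = sperm Q z"
      by auto
    define w where "w = (inv\<^bsub>perm_group\<^esub> g) x"
    have w: "w \<in> carrier Q" "smap Q z w = x"
      using z inv.prems BijGroup_inv_apply(2)[of g "carrier Q" x]
        BijGroup_apply_closed[of "inv\<^bsub>perm_group\<^esub> g" "carrier Q" x]
        sperm_in_BijGroup[of z] group.inv_closed[OF group_perm_group, of g]
      by (auto simp: w_def)
    obtain h where h: "h \<in> displacements" "h w = x"
      using step[OF w(1) z(1)] w(2) by auto
    then show ?case
      using displacement_inv(1,2)[OF h(1)] w(1) unfolding w_def[symmetric] by auto
  next
    case (eng g g')
    have C: "g \<in> carrier perm_group" "g' \<in> carrier perm_group"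
      using eng.hyps group.generate_in_carrier[OF group_perm_group sub] by auto
    obtain h' where h': "h' \<in> displacements" "h' x = g' x"
      using eng.IH(2) eng.prems by blast
    obtain h where h: "h \<in> displacements" "h (g' x) = g (g' x)"
      using eng.IH(1)[of "g' x"] BijGroup_apply_closed[OF C(2) eng.prems] by blast
    show ?case
      using tr[OF h'(1) h(1) h'(2) h(2) eng.prems] C eng.prems by (simp add: BijGroup_mult_apply)
  qed
  obtain g where "g \<in> carrier (Inn Q)" "g x = y"
    using assms transitive_action.unique_orbit[of "Inn Q" "carrier Q" "\<lambda>g. g" x y]
    by (auto simp: quandle_connected_def)
  moreover have "carrier (Inn Q) = generate perm_group {sperm Q x | x. x \<in> carrier Q}"
    using sub by (simp add: Inn_def carrier_subgroup_generated Int_absorb1)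
  ultimately show thesis
    using orbit[of g x] assms(2) that by auto
qed

end

section \<open>Flat connected quandles are cores\<close>

locale flat_connected_quandle = quandle +
  assumes flat: "quandle_flat Q" and connected: "quandle_connected Q"
begin

sublocale D: comm_group "displacement_group Q"
  using flat by (simp add: quandle_flat_def)

lemma displacement_commute:
  assumes "g \<in> displacements" "h \<in> displacements" "x \<in> carrier Q"
  shows "g (h x) = h (g x)"
  using D.m_comm[OF assms(1,2)] assms by (metis displacement_mult(2) mult_displacement_group)

text \<open>
  The displacement $s_x s_x$ fixes $x$. Any other point is $g(x)$ for a displacement $g$, and
  it is fixed as well because $g$ commutes with $s_x s_x$.
\<close>

lemma smap_involutive:
  assumes "x \<in> carrier Q" "y \<in> carrier Q"
  shows "smap Q x (smap Q x y) = y"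
proof -
  obtain g where g: "g \<in> displacements" "g x = y"
    by (rule displacements_transitive[OF connected assms])
  obtain d where d: "d \<in> displacements" "\<forall>z\<in>carrier Q. d z = smap Q x (smap Q x z)"
    by (rule displacement_gen[OF assms(1,1)])
  have "d (g x) = g (d x)"
    using d(1) g(1) assms(1) by (rule displacement_commute)
  then show ?thesis
    using d(2) g(2) assms by (simp add: Q1)
qed

text \<open>
  Equivalently $s_x g s_x = g^{-1}$. For a generator $g = s_a s_b$ one has
  $g s_x g = (s_a s_b)(s_x s_a) s_b$. Commuting the two displacements turns this into
  $(s_x s_a)(s_a s_b) s_b$, which is $s_x$ because $s_a$ and $s_b$ are involutions.
\<close>

lemma smap_inverts_displacement:
  assumes "g \<in> displacements" "x \<in> carrier Q" "y \<in> carrier Q"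
  shows "g (smap Q x (g y)) = smap Q x y"
  using assms(1) assms(2,3)
proof (induction g arbitrary: y rule: displacements_induct)
  case (gen g a b)
  obtain h where h: "h \<in> displacements" "\<forall>z\<in>carrier Q. h z = smap Q x (smap Q a z)"
    by (rule displacement_gen[OF gen(5) gen(2)])
  have "g (smap Q x (g y)) = g (h (smap Q b y))"
    using gen h(2) by simp
  also have "\<dots> = h (g (smap Q b y))"
    by (rule displacement_commute) (use gen h(1) in auto)
  also have "\<dots> = smap Q x y"
    using gen h(2) by (simp add: smap_involutive)
  finally show ?case .
next
  case (mult g h)
  have "g (h (smap Q x (g (h y)))) = g (h (smap Q x (h (g y))))"
    using mult by (simp add: displacement_commute)
  then show ?case
    using mult by (simp add: displacement_mult)
next
  case (inv g)
  let ?h = "inv\<^bsub>perm_group\<^esub> g"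
  have h: "?h y \<in> carrier Q"
    using inv by (simp add: displacement_inv(1))
  have "smap Q x (?h y) = g (smap Q x y)"
    using inv.IH[of "?h y"] inv h by (simp add: displacement_inv(3))
  then show ?case
    using inv by (simp add: displacement_inv(2))
qed simp

text \<open>
  As $g$ is an automorphism, $s_{g(x)} = g s_x g^{-1}$; moving $g^{-1}$ past $s_x$ inverts it.
\<close>

lemma smap_displacement:
  assumes "g \<in> displacements" "x \<in> carrier Q" "y \<in> carrier Q"
  shows "smap Q (g x) y = g (g (smap Q x y))"
proof -
  let ?z = "(inv\<^bsub>perm_group\<^esub> g) y"
  have z: "?z \<in> carrier Q" "g ?z = y"
    using assms by (simp_all add: displacement_inv)
  have "smap Q (g x) y = g (smap Q x ?z)"
    using assms z displacement_smap[of g x ?z] by simp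
  also have "smap Q x ?z = g (smap Q x (g ?z))"
    using assms(1,2) z(1) by (rule smap_inverts_displacement[symmetric])
  finally show ?thesis
    using z(2) by simp
qed

text \<open>
  If $h(y) = x$, then $s_x s_y = h^2 s_y s_y = h^2$, so the generators are squares. In an
  abelian group the squares form a subgroup.
\<close>

lemma displacements_squares:
  "displacements \<subseteq> (\<lambda>g. g \<otimes>\<^bsub>displacement_group Q\<^esub> g) ` displacements"
proof
  fix g assume "g \<in> displacements"
  then have "\<exists>h\<in>displacements. g = h \<otimes>\<^bsub>perm_group\<^esub> h"
  proof (induction g rule: displacements_induct)
    case one
    show ?case
      using D.one_closed D.l_one[OF D.one_closed] by (intro bexI[of _ "\<one>\<^bsub>perm_group\<^esub>"]) (simp_all add: displacement_group_eq)
  next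
    case (gen g x y)
    obtain h where h: "h \<in> displacements" "h y = x"
      by (rule displacements_transitive[OF connected gen(3) gen(2)])
    have "g = h \<otimes>\<^bsub>perm_group\<^esub> h"
    proof (rule BijGroup_eqI)
      show "g \<in> carrier perm_group" "h \<otimes>\<^bsub>perm_group\<^esub> h \<in> carrier perm_group"
        using gen(1) h(1) displacement_mult(1) by (auto intro: displacements_in_perm_group)
      show "g z = (h \<otimes>\<^bsub>perm_group\<^esub> h) z" if "z \<in> carrier Q" for z
        using gen h that smap_displacement[of h y "smap Q y z"]
        by (simp add: displacement_mult smap_involutive)
    qed
    then show ?case
      using h(1) by blast
  next
    case (mult g g')
    then obtain h h' where h: "h \<in> displacements" "g = h \<otimes>\<^bsub>perm_group\<^esub> h"
      "h' \<in> displacements" "g' = h' \<otimes>\<^bsub>perm_group\<^esub> h'"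
      by blast
    then show ?case
      using D.m_ac D.m_closed by (intro bexI[of _ "h \<otimes>\<^bsub>perm_group\<^esub> h'"]) simp_all
  next
    case (inv g)
    then obtain h where h: "h \<in> displacements" "g = h \<otimes>\<^bsub>perm_group\<^esub> h"
      by blast
    then show ?case
      using D.inv_mult[OF h(1) h(1)] D.inv_closed[OF h(1)] D.m_closed[OF h(1) h(1)]
      by (intro bexI[of _ "inv\<^bsub>perm_group\<^esub> h"]) simp_all
  qed
  then show "g \<in> (\<lambda>g. g \<otimes>\<^bsub>displacement_group Q\<^esub> g) ` displacements"
    by auto
qed

text \<open>
  Two displacements that agree at $x$ agree at every point $k(x)$, because $k$ commutes with both.
\<close>

lemma displacements_regular:
  assumes "x \<in> carrier Q"
  shows "bij_betw (\<lambda>g. g x) displacements (carrier Q)"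
  unfolding bij_betw_def
proof
  show "inj_on (\<lambda>g. g x) displacements"
  proof (rule inj_onI)
    fix g h assume gh: "g \<in> displacements" "h \<in> displacements" "g x = h x"
    show "g = h"
    proof (rule BijGroup_eqI)
      fix y assume "y \<in> carrier Q"
      then obtain k where k: "k \<in> displacements" "k x = y"
        by (rule displacements_transitive[OF connected assms])
      have "g (k x) = k (g x)" "h (k x) = k (h x)"
        using gh(1,2) k(1) assms by (auto intro: displacement_commute)
      then show "g y = h y"
        using gh(3) k(2) by simp
    qed (use gh in \<open>auto intro: displacements_in_perm_group\<close>)
  qed
  show "(\<lambda>g. g x) ` displacements = carrier Q"
  proof
    show "(\<lambda>g. g x) ` displacements \<subseteq> carrier Q"
      using assms by auto
    show "carrier Q \<subseteq> (\<lambda>g. g x) ` displacements"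
    proof
      fix y assume "y \<in> carrier Q"
      then obtain g where "g \<in> displacements" "g x = y"
        by (rule displacements_transitive[OF connected assms])
      then show "y \<in> (\<lambda>g. g x) ` displacements"
        by blast
    qed
  qed
qed

text \<open>
  Evaluation at a base point $x$ is an isomorphism: $s_x(h(x)) = h^{-1}(x)$ since $s_x$ fixes $x$
  and inverts $h$, and therefore $s_{g(x)}(h(x)) = g g h^{-1}(x) = g h^{-1} g (x)$.
\<close>

theorem core_displacement_group_isomorphic:
  "quandle_isomorphic (core_quandle (displacement_group Q)) Q"
proof -
  obtain x where x: "x \<in> carrier Q"
    using connected by (auto simp: quandle_connected_def)
  have "(g \<otimes>\<^bsub>perm_group\<^esub> inv\<^bsub>displacement_group Q\<^esub> h \<otimes>\<^bsub>perm_group\<^esub> g) x = smap Q (g x) (h x)"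
    if gh: "g \<in> displacements" "h \<in> displacements" for g h
  proof -
    let ?h = "inv\<^bsub>perm_group\<^esub> h"
    have "?h x = smap Q x (h x)"
      using smap_inverts_displacement[OF gh(2) x x] gh(2) x displacement_inv(2)[OF gh(2), of "smap Q x (h x)"]
      by (simp add: Q1)
    have "(g \<otimes>\<^bsub>perm_group\<^esub> inv\<^bsub>displacement_group Q\<^esub> h \<otimes>\<^bsub>perm_group\<^esub> g) x = g (?h (g x))"
      using gh x by (simp add: displacement_mult displacement_inv(1))
    also have "\<dots> = g (g (?h x))"
      using gh x displacement_commute[OF _ gh(1) x, of ?h] by (simp add: displacement_inv(1))
    also have "\<dots> = smap Q (g x) (h x)"
      using gh x \<open>?h x = _\<close> by (simp add: smap_displacement)
    finally show ?thesis .
  qed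
  then have "(\<lambda>g. g x) \<in> quandle_hom (core_quandle (displacement_group Q)) Q"
    using x by (simp add: quandle_hom_def core_quandle_def)
  moreover have "bij_betw (\<lambda>g. g x) (carrier (core_quandle (displacement_group Q))) (carrier Q)"
    using displacements_regular[OF x] by (simp add: core_quandle_def)
  ultimately show ?thesis
    unfolding quandle_isomorphic_def by (intro bexI)
qed

end

section \<open>Products of dihedral quandles\<close>

text \<open>
  For odd $n$ the number $(n + 1)/2$ is the inverse of $2$ modulo $n$, so the reflection in
  $(a + b)(n + 1)/2$ takes $a$ to $b$.
\<close>

lemma dihedral_midpoint:
  fixes a b :: int
  assumes "odd n" "b \<in> {0..<int n}"
  shows "(2 * ((a + b) * ((int n + 1) div 2) mod int n) - a) mod int n = b"
proof -
  have "2 * ((int n + 1) div 2) = int n + 1"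
    using assms(1) by (intro dvd_mult_div_cancel) simp
  then have half: "2 * ((a + b) * ((int n + 1) div 2)) = (a + b) * (int n + 1)"
    by (metis mult.left_commute)
  have "(2 * ((a + b) * ((int n + 1) div 2) mod int n) - a) mod int n
      = (2 * ((a + b) * ((int n + 1) div 2)) - a) mod int n"
    by (metis mod_diff_left_eq mod_mult_right_eq)
  also have "\<dots> = (b + (a + b) * int n) mod int n"
    unfolding half by (simp add: algebra_simps)
  also have "\<dots> = b"
    using assms(2) by simp
  finally show ?thesis .
qed

context quandle
begin

text \<open>
  All three properties are verified for $Q$ itself, with the components of the isomorphism as
  coordinates: the permutation $s_x s_y$ adds $2x - 2y$ to the coordinates, and midpoints give
  transitivity.
\<close>

lemma flat_connected_finite_if_isomorphic_dihedral_prod: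
  fixes q :: "'i \<Rightarrow> nat"
  assumes fin: "finite I" and odd: "\<And>i. i \<in> I \<Longrightarrow> odd (q i)"
    and iso: "quandle_isomorphic Q (quandle_prod I (\<lambda>i. dihedral_quandle (q i)))"
  shows "quandle_flat Q" "quandle_connected Q" "finite (carrier Q)"
proof -
  let ?P = "\<Pi>\<^sub>E i\<in>I. {0..<int (q i)}"
  obtain f where "\<forall>x\<in>carrier Q. \<forall>y\<in>carrier Q.
      f (smap Q x y) = (\<lambda>i\<in>I. (2 * f x i - f y i) mod int (q i))"
    and bij: "bij_betw f (carrier Q) ?P"
    using iso by (auto simp: quandle_isomorphic_def quandle_hom_def quandle_prod_def dihedral_quandle_def)
  then have hom: "f (smap Q x y) = (\<lambda>i\<in>I. (2 * f x i - f y i) mod int (q i))"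
    if "x \<in> carrier Q" "y \<in> carrier Q" for x y
    using that by blast
  have eqI: "x = y" if "f x = f y" "x \<in> carrier Q" "y \<in> carrier Q" for x y
    using bij_betw_imp_inj_on[OF bij] that by (rule inj_onD)
  have fP: "f x \<in> ?P" if "x \<in> carrier Q" for x
    using bij_betwE[OF bij] that by blast
  show "finite (carrier Q)"
    using bij_betw_finite[OF bij] fin by (simp add: finite_PiE)

  have swap: "smap Q x (smap Q y (smap Q z (smap Q w u))) = smap Q z (smap Q w (smap Q x (smap Q y u)))"
    if "x \<in> carrier Q" "y \<in> carrier Q" "z \<in> carrier Q" "w \<in> carrier Q" "u \<in> carrier Q" for x y z w u
  proof (rule eqI)
    have two: "f (smap Q a (smap Q b c)) = (\<lambda>i\<in>I. (2 * f a i - 2 * f b i + f c i) mod int (q i))"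
      if "a \<in> carrier Q" "b \<in> carrier Q" "c \<in> carrier Q" for a b c
      using that by (simp add: hom mod_diff_right_eq diff_diff_eq2 diff_add_eq cong: restrict_cong)
    have "(2 * a - 2 * b + (2 * c - 2 * d + e) mod k) mod k = (2 * c - 2 * d + (2 * a - 2 * b + e) mod k) mod k"
      for a b c d e k :: int
      by (simp add: mod_add_right_eq add.left_commute)
    then show "f (smap Q x (smap Q y (smap Q z (smap Q w u)))) = f (smap Q z (smap Q w (smap Q x (smap Q y u))))"
      using that by (simp add: two cong: restrict_cong)
  qed (use that in simp_all)
  have "comm_group (subgroup_generated perm_group displacement_gens)"
  proof (rule group.comm_group_subgroup_generated[OF group_perm_group displacement_gens_subset])
    fix g h assume gh: "g \<in> displacement_gens" "h \<in> displacement_gens"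
    then have C: "g \<in> carrier perm_group" "h \<in> carrier perm_group"
      using displacement_gens_subset by auto
    obtain x y z w where xy: "x \<in> carrier Q" "y \<in> carrier Q" "g = sperm Q x \<otimes>\<^bsub>perm_group\<^esub> sperm Q y"
      and zw: "z \<in> carrier Q" "w \<in> carrier Q" "h = sperm Q z \<otimes>\<^bsub>perm_group\<^esub> sperm Q w"
      using gh by (auto simp: displacement_gens_def)
    have g: "g u = smap Q x (smap Q y u)" and h: "h u = smap Q z (smap Q w u)" if "u \<in> carrier Q" for u
      using xy zw that by (simp_all add: BijGroup_mult_apply sperm_in_BijGroup)
    show "g \<otimes>\<^bsub>perm_group\<^esub> h = h \<otimes>\<^bsub>perm_group\<^esub> g"
    proof (rule BijGroup_eqI)
      show "g \<otimes>\<^bsub>perm_group\<^esub> h \<in> carrier perm_group" "h \<otimes>\<^bsub>perm_group\<^esub> g \<in> carrier perm_group"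
        using C monoid.m_closed[OF group.is_monoid[OF group_perm_group]] by auto
      show "(g \<otimes>\<^bsub>perm_group\<^esub> h) u = (h \<otimes>\<^bsub>perm_group\<^esub> g) u" if "u \<in> carrier Q" for u
        using that C xy(1,2) zw(1,2) swap by (simp add: BijGroup_mult_apply g h)
    qed
  qed
  then show "quandle_flat Q"
    by (simp add: quandle_flat_def displacement_group_eq)

  have q0: "0 < q i" if "i \<in> I" for i
    using odd[OF that] by (rule odd_pos)
  then have "(\<lambda>i\<in>I. 0) \<in> ?P"
    by auto
  then have "(\<lambda>i\<in>I. 0) \<in> f ` carrier Q"
    using bij by (simp add: bij_betw_def)
  then have nonempty: "carrier Q \<noteq> {}"
    by blast
  have orbit: "\<exists>z\<in>carrier Q. smap Q z x = y" if xy: "x \<in> carrier Q" "y \<in> carrier Q" for x y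
  proof -
    define v where "v = (\<lambda>i\<in>I. (f x i + f y i) * ((int (q i) + 1) div 2) mod int (q i))"
    have "v \<in> ?P"
      using q0 by (auto simp: v_def)
    then have "v \<in> f ` carrier Q"
      using bij by (simp add: bij_betw_def)
    then obtain z where z: "z \<in> carrier Q" "f z = v"
      by blast
    have "f (smap Q z x) = f y"
    proof
      fix i
      show "f (smap Q z x) i = f y i"
      proof (cases "i \<in> I")
        case True
        have "f y i \<in> {0..<int (q i)}"
          using fP[OF xy(2)] True by (rule PiE_mem)
        then show ?thesis
          using True dihedral_midpoint[OF odd[OF True], of "f y i" "f x i"]
          by (simp add: hom[OF z(1) xy(1)] z(2) v_def)
      next
        case False
        then show ?thesis
          using PiE_arb[OF fP[OF xy(2)] False] by (simp add: hom[OF z(1) xy(1)])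
      qed
    qed
    then show ?thesis
      using z(1) xy eqI[of "smap Q z x" y] by auto
  qed
  have gens: "{sperm Q x | x. x \<in> carrier Q} \<subseteq> carrier perm_group"
    using sperm_in_BijGroup by auto
  have "transitive_action (Inn Q) (carrier Q) (\<lambda>g. g)"
  proof (intro transitive_action.intro group_action.intro transitive_action_axioms.intro)
    have "(\<lambda>g. g) \<in> hom (Inn Q) perm_group"
      using group.carrier_subgroup_generated_subset[OF group_perm_group]
      by (auto simp: hom_def Inn_def)
    then show "group_hom (Inn Q) perm_group (\<lambda>g. g)"
      by (intro group_hom.intro group_hom_axioms.intro group_perm_group)
        (simp add: Inn_def group.group_subgroup_generated[OF group_perm_group])
    show "\<exists>g\<in>carrier (Inn Q). g x = y" if xy: "x \<in> carrier Q" "y \<in> carrier Q" for x y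
    proof -
      obtain z where z: "z \<in> carrier Q" "smap Q z x = y"
        using orbit[OF xy] by blast
      have "sperm Q z \<in> carrier (Inn Q)"
        using z(1) group.subgroup_generated_subset_carrier_subset[OF group_perm_group gens]
        by (auto simp: Inn_def)
      then show ?thesis
        using z xy by (intro bexI[of _ "sperm Q z"]) simp_all
    qed
  qed
  then show "quandle_connected Q"
    using nonempty by (simp add: quandle_connected_def)
qed

end

section \<open>The classification\<close>

theorem theorem1p1:
  fixes Q :: "'a quandle"
  assumes "quandle Q"
  shows "quandle_flat Q \<and> quandle_connected Q \<and> finite (carrier Q) \<longleftrightarrow>
    (\<exists>(n::nat) (q :: nat \<Rightarrow> nat). (\<forall>i<n. odd (q i) \<and> primepow (q i)) \<and>
       quandle_isomorphic Q (quandle_prod {..<n} (\<lambda>i. dihedral_quandle (q i))))"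
proof
  interpret quandle Q
    by (rule assms)
  assume "quandle_flat Q \<and> quandle_connected Q \<and> finite (carrier Q)"
  then have flat: "quandle_flat Q" and connected: "quandle_connected Q" and fin: "finite (carrier Q)"
    by auto
  interpret flat_connected_quandle Q
    using flat connected by unfold_locales
  obtain x where "x \<in> carrier Q"
    using connected by (auto simp: quandle_connected_def)
  then have "finite displacements"
    using displacements_regular[of x] fin by (simp add: bij_betw_finite)
  then obtain n :: nat and q :: "nat \<Rightarrow> nat" where q: "\<And>i. i < n \<Longrightarrow> odd (q i) \<and> primepow (q i)"
    and iso: "quandle_isomorphic (quandle_prod {..<n} (\<lambda>i. dihedral_quandle (q i)))
      (core_quandle (displacement_group Q))"
    using D.core_quandle_decomposition displacements_squares by metis
  have "quandle_isomorphic (quandle_prod {..<n} (\<lambda>i. dihedral_quandle (q i))) Q"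
    using iso core_displacement_group_isomorphic by (rule quandle_isomorphic_trans)
  then have "quandle_isomorphic Q (quandle_prod {..<n} (\<lambda>i. dihedral_quandle (q i)))"
    by (rule quandle_isomorphic_sym[OF quandle_quandle_prod[OF quandle_dihedral_quandle]])
  then show "\<exists>(n::nat) (q :: nat \<Rightarrow> nat). (\<forall>i<n. odd (q i) \<and> primepow (q i)) \<and>
       quandle_isomorphic Q (quandle_prod {..<n} (\<lambda>i. dihedral_quandle (q i)))"
    using q by blast
next
  assume "\<exists>(n::nat) (q :: nat \<Rightarrow> nat). (\<forall>i<n. odd (q i) \<and> primepow (q i)) \<and>
       quandle_isomorphic Q (quandle_prod {..<n} (\<lambda>i. dihedral_quandle (q i)))"
  then obtain n :: nat and q :: "nat \<Rightarrow> nat" where "\<And>i. i \<in> {..<n} \<Longrightarrow> odd (q i)"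
    "quandle_isomorphic Q (quandle_prod {..<n} (\<lambda>i. dihedral_quandle (q i)))"
    by auto
  then show "quandle_flat Q \<and> quandle_connected Q \<and> finite (carrier Q)"
    using quandle.flat_connected_finite_if_isomorphic_dihedral_prod[OF assms finite_lessThan] by blast
qed

end
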